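(* Let $L/K$ be a G-extension. Then for every intermediate field $K\subseteq M\subseteq L$, the field extension $L/M$ is a G-extension.
   Context: For a finite field extension $L/F$, let $G(L/F)$ be the group of $F$-algebra automorphisms of $L$ and $E(L/F)=\mathrm{End}_F(L)$ the algebra of $F$-linear endomorphisms of $L$. The group $G(L/F)$ is a subset of $E(L/F)$, and $L$ is regarded as a subalgebra of $E(L/F)$ via multiplication. $L\rtimes G(L/F)$ denotes the $F$-subalgebra of $E(L/F)$ generated by $L$ and $G(L/F)$, i.e. $\sum_{g\in G(L/F)}Lg$ (this sum is direct, with multiplication $\lambda g\cdot\mu h=\lambda g(\mu)gh$). A finite field extension $L/F$ is called a G-extension if $E(L/F)=L\rtimes G(L/F)$. *)

theory Defs
  imports "HOL-Algebra.Algebra"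
begin

text \<open>
  A field extension \<open>L/F\<close> is given by a HOL-Algebra field \<open>L\<close> together with a subfield
  \<open>F\<close> of \<open>L\<close>. Maps \<open>L \<rightarrow> L\<close> are represented by functions that are \<^const>\<open>undefined\<close> outside
  \<^term>\<open>carrier L\<close>, so that equality of maps is equality of HOL functions.
\<close>

definition end_algebra :: "('a, 'm) ring_scheme \<Rightarrow> 'a set \<Rightarrow> ('a \<Rightarrow> 'a) ring"
  where "end_algebra L F =
    \<lparr> carrier = {f \<in> carrier L \<rightarrow>\<^sub>E carrier L.
         (\<forall>x\<in>carrier L. \<forall>y\<in>carrier L. f (x \<oplus>\<^bsub>L\<^esub> y) = f x \<oplus>\<^bsub>L\<^esub> f y) \<and>
         (\<forall>a\<in>F. \<forall>x\<in>carrier L. f (a \<otimes>\<^bsub>L\<^esub> x) = a \<otimes>\<^bsub>L\<^esub> f x)},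
      monoid.mult = compose (carrier L),
      one = (\<lambda>x\<in>carrier L. x),
      ring.zero = (\<lambda>x\<in>carrier L. \<zero>\<^bsub>L\<^esub>),
      ring.add = (\<lambda>f g. \<lambda>x\<in>carrier L. f x \<oplus>\<^bsub>L\<^esub> g x) \<rparr>"

definition gal :: "('a, 'm) ring_scheme \<Rightarrow> 'a set \<Rightarrow> ('a \<Rightarrow> 'a) set"
  where "gal L F = {g \<in> ring_iso L L \<inter> extensional (carrier L). \<forall>a\<in>F. g a = a}"

definition mult_map :: "('a, 'm) ring_scheme \<Rightarrow> 'a \<Rightarrow> 'a \<Rightarrow> 'a"
  where "mult_map L a = (\<lambda>x\<in>carrier L. a \<otimes>\<^bsub>L\<^esub> x)"

text \<open>
  In HOL-Algebra, \<^const>\<open>subalgebra\<close> only requires an additive subgroup closed under scalars; an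
  \<open>F\<close>-subalgebra of \<^term>\<open>end_algebra L F\<close> in the usual sense is in addition a subring.
  The scalars \<open>F\<close> sit in \<^term>\<open>end_algebra L F\<close> as multiplication maps.
\<close>

definition crossed_algebra :: "('a, 'm) ring_scheme \<Rightarrow> 'a set \<Rightarrow> ('a \<Rightarrow> 'a) set"
  where "crossed_algebra L F =
    \<Inter> {A. subring A (end_algebra L F) \<and>
          subalgebra (mult_map L ` F) A (end_algebra L F) \<and>
          mult_map L ` carrier L \<subseteq> A \<and> gal L F \<subseteq> A}"

definition G_extension :: "('a, 'm) ring_scheme \<Rightarrow> 'a set \<Rightarrow> bool"
  where "G_extension L F \<longleftrightarrow>
    field L \<and> subfield F L \<and> ring.finite_dimension L F (carrier L) \<and>
    carrier (end_algebra L F) = crossed_algebra L F"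

lemma ring_end_algebra:
  assumes "field L" "subfield F L"
  shows "ring (end_algebra L F)"
proof -
  interpret L: field L by fact
  have F: "a \<in> carrier L" if "a \<in> F" for a
    using that subfieldE(3)[OF assms(2)] by auto
  show ?thesis
  proof (rule ringI)
    show "abelian_group (end_algebra L F)"
    proof (rule abelian_groupI)
      fix f assume f: "f \<in> carrier (end_algebra L F)"
      let ?g = "\<lambda>x\<in>carrier L. \<ominus>\<^bsub>L\<^esub> f x"
      have "?g \<in> carrier (end_algebra L F)"
        using f F by (auto simp: end_algebra_def PiE_iff L.minus_add L.r_minus)
      moreover have "?g \<oplus>\<^bsub>end_algebra L F\<^esub> f = \<zero>\<^bsub>end_algebra L F\<^esub>"
        using f by (auto simp: end_algebra_def PiE_iff L.l_neg)
      ultimately show "\<exists>g\<in>carrier (end_algebra L F). g \<oplus>\<^bsub>end_algebra L F\<^esub> f = \<zero>\<^bsub>end_algebra L F\<^esub>"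
        by blast
    qed (auto simp: end_algebra_def PiE_iff fun_eq_iff extensional_def F L.r_distr
              L.a_ac)
    show "Group.monoid (end_algebra L F)"
      by (rule monoidI)
        (auto simp: end_algebra_def PiE_iff fun_eq_iff extensional_def compose_def F)
  qed (auto simp: end_algebra_def PiE_iff fun_eq_iff extensional_def compose_def F)
qed

lemma gal_subset_end_algebra:
  assumes "F \<subseteq> carrier L"
  shows "gal L F \<subseteq> carrier (end_algebra L F)"
  using assms
  by (auto simp: gal_def end_algebra_def ring_iso_def ring_hom_def PiE_iff subset_iff)

lemma mult_map_in_end_algebra:
  assumes "field L" "F \<subseteq> carrier L" "a \<in> carrier L"
  shows "mult_map L a \<in> carrier (end_algebra L F)"
proof -
  interpret L: field L by fact
  show ?thesis
    using assms by (auto simp: mult_map_def end_algebra_def PiE_iff subset_iff L.r_distr L.m_lcomm)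
qed

end

theory Submission
  imports Defs
begin

text \<open>
  An \<open>M\<close>-linear endomorphism \<open>f\<close> of \<open>L\<close> is also \<open>K\<close>-linear, so, \<open>L/K\<close> being a G-extension, it is a
  finite sum \<open>f = \<Sum> a\<^sub>g g\<close> over automorphisms \<open>g \<in> G(L/K)\<close>. The point is that the automorphisms that
  really occur fix \<open>M\<close>: comparing \<open>f (m x)\<close> with \<open>m f x\<close> for \<open>m \<in> M\<close> gives
  \<open>\<Sum> a\<^sub>g (g m - m) g = 0\<close>, and by Dedekind's independence of characters
  (\<open>independence_of_characters\<close>) each coefficient \<open>a\<^sub>g (g m - m)\<close> vanishes. Hence \<open>a\<^sub>g = 0\<close> unless \<open>g\<close>
  fixes \<open>M\<close> pointwise (\<open>combination_commuting_with_subfield\<close>), so \<open>f\<close> lies in \<open>L \<rtimes> G(L/M)\<close>.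

  For this argument \<open>L \<rtimes> G(L/K)\<close>, defined as the smallest subalgebra containing \<open>L\<close> and
  \<open>G(L/K)\<close>, has to be identified with the set of sums \<open>\<Sum> a\<^sub>g g\<close>; the rule \<open>g \<circ> b = g(b) g\<close> makes
  these sums closed under composition (\<open>subring_combinations\<close>). Finiteness of \<open>L/M\<close> holds because a
  list that spans \<open>L\<close> over \<open>K\<close> also spans it over \<open>M\<close>.
\<close>

section \<open>Independence of characters\<close>

text \<open>
  Induction on the number of characters: if \<open>h\<close> is one of them, replacing \<open>x\<close> by \<open>y x\<close> in the relation
  and subtracting \<open>h y\<close> times the relation removes \<open>h\<close> and leaves the coefficients
  \<open>c\<^sub>g (g y - h y)\<close> for the others.
\<close>

lemma (in domain) independence_of_characters:
  fixes S :: "('c, 'd) monoid_scheme"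
  assumes "Group.monoid S" and "finite A"
    and "\<And>g. g \<in> A \<Longrightarrow> g \<in> hom S R \<inter> extensional (carrier S) \<and> g \<one>\<^bsub>S\<^esub> = \<one>"
    and "c \<in> A \<rightarrow> carrier R"
    and "\<And>x. x \<in> carrier S \<Longrightarrow> (\<Oplus>g\<in>A. c g \<otimes> g x) = \<zero>"
    and "g \<in> A"
  shows "c g = \<zero>"
  using assms(2-)
proof (induction A arbitrary: c g rule: finite_induct)
  case empty
  then show ?case by simp
next
  case (insert h A)
  interpret S: Group.monoid S by fact
  have hom: "k \<in> hom S R" "k \<one>\<^bsub>S\<^esub> = \<one>" "k \<in> extensional (carrier S)" if "k \<in> insert h A" for k
    using insert.prems(1) that by auto
  have val: "k x \<in> carrier R" if "k \<in> insert h A" "x \<in> carrier S" for k x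
    using hom(1)[OF that(1)] that(2) by (rule hom_in_carrier)
  have c: "c k \<in> carrier R" if "k \<in> insert h A" for k
    using insert.prems(2) that by auto
  have sum_closed: "(\<Oplus>k\<in>A. c k \<otimes> k x) \<in> carrier R" if "x \<in> carrier S" for x
    using that val c by (intro finsum_closed) auto
  have split: "c h \<otimes> h x \<oplus> (\<Oplus>k\<in>A. c k \<otimes> k x) = \<zero>" if "x \<in> carrier S" for x
    using insert.prems(3)[OF that] finsum_insert[OF insert.hyps, of "\<lambda>k. c k \<otimes> k x"] val c that
    by (simp add: Pi_def)
  have zero_on_A: "c k = \<zero>" if k: "k \<in> A" for k
  proof -
    have "k \<noteq> h" using k insert.hyps by auto
    then obtain y where y: "y \<in> carrier S" "k y \<noteq> h y"
      using hom(3)[of k] hom(3)[of h] k by (metis extensionalityI insertCI)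
    have "c k \<otimes> (k y \<ominus> h y) = \<zero>"
    proof (rule insert.IH[of "\<lambda>k. c k \<otimes> (k y \<ominus> h y)"])
      fix x assume x: "x \<in> carrier S"
      have "(\<Oplus>k\<in>A. c k \<otimes> (k y \<ominus> h y) \<otimes> k x)
          = (\<Oplus>k\<in>A. c k \<otimes> k (y \<otimes>\<^bsub>S\<^esub> x) \<oplus> \<ominus> h y \<otimes> (c k \<otimes> k x))"
      proof (rule finsum_cong')
        fix k assume "k \<in> A"
        then have k: "k \<in> insert h A" by simp
        have "k (y \<otimes>\<^bsub>S\<^esub> x) = k y \<otimes> k x" using hom_mult[OF hom(1)[OF k] y(1) x] .
        then show "c k \<otimes> (k y \<ominus> h y) \<otimes> k x = c k \<otimes> k (y \<otimes>\<^bsub>S\<^esub> x) \<oplus> \<ominus> h y \<otimes> (c k \<otimes> k x)"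
          using c[OF k] val[OF k y(1)] val[OF k x] val[of h y] y(1)
            by (simp add: a_minus_def l_distr r_distr l_minus r_minus m_ac)
      qed (use c val x y in auto)
      also have "\<dots> = (\<Oplus>k\<in>A. c k \<otimes> k (y \<otimes>\<^bsub>S\<^esub> x)) \<oplus> (\<Oplus>k\<in>A. \<ominus> h y \<otimes> (c k \<otimes> k x))"
        using c val x y by (intro finsum_addf) auto
      also have "(\<Oplus>k\<in>A. \<ominus> h y \<otimes> (c k \<otimes> k x)) = \<ominus> h y \<otimes> (\<Oplus>k\<in>A. c k \<otimes> k x)"
        using insert.hyps c val x y by (intro finsum_rdistr[symmetric]) auto
      also have "(\<Oplus>k\<in>A. c k \<otimes> k (y \<otimes>\<^bsub>S\<^esub> x)) \<oplus> \<ominus> h y \<otimes> (\<Oplus>k\<in>A. c k \<otimes> k x) = \<zero>"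
      proof -
        have "h (y \<otimes>\<^bsub>S\<^esub> x) = h y \<otimes> h x" using hom_mult[OF hom(1) y(1) x] by simp
        then have "c h \<otimes> (h y \<otimes> h x) \<oplus> (\<Oplus>k\<in>A. c k \<otimes> k (y \<otimes>\<^bsub>S\<^esub> x)) = \<zero>"
          using split[of "y \<otimes>\<^bsub>S\<^esub> x"] x y by simp
        then have "\<ominus> (\<Oplus>k\<in>A. c k \<otimes> k (y \<otimes>\<^bsub>S\<^esub> x)) = c h \<otimes> (h y \<otimes> h x)"
          using sum_closed[of "y \<otimes>\<^bsub>S\<^esub> x"] x y(1) c[of h] val[of h x] val[of h y]
          by (intro minus_equality) auto
        moreover have "\<ominus> (\<Oplus>k\<in>A. c k \<otimes> k x) = c h \<otimes> h x"
          using split[OF x] sum_closed[OF x] x c[of h] val[of h x] by (intro minus_equality) auto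
        then have "\<ominus> h y \<otimes> (\<Oplus>k\<in>A. c k \<otimes> k x) = h y \<otimes> (c h \<otimes> h x)"
          using sum_closed[OF x] val[of h y] y(1) by (simp add: l_minus flip: r_minus)
        ultimately have "\<ominus> h y \<otimes> (\<Oplus>k\<in>A. c k \<otimes> k x) = \<ominus> (\<Oplus>k\<in>A. c k \<otimes> k (y \<otimes>\<^bsub>S\<^esub> x))"
          using x y(1) c[of h] val[of h x] val[of h y] by (simp add: m_lcomm)
        then show ?thesis
          using sum_closed[of "y \<otimes>\<^bsub>S\<^esub> x"] x y(1) by (simp add: r_neg)
      qed
      finally show "(\<Oplus>k\<in>A. c k \<otimes> (k y \<ominus> h y) \<otimes> k x) = \<zero>" .
    qed (use insert.prems(1) c val y k in auto)
    moreover have "k y \<ominus> h y \<noteq> \<zero>"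
      using y val[of k y] val[of h y] k by (simp add: r_right_minus_eq)
    ultimately show ?thesis
      using c[of k] val[of k y] val[of h y] k y integral[of "c k" "k y \<ominus> h y"] by auto
  qed
  have "(\<Oplus>k\<in>A. c k \<otimes> k \<one>\<^bsub>S\<^esub>) = (\<Oplus>k\<in>A. \<zero>)"
    using zero_on_A val by (intro finsum_cong') auto
  then have "c h = \<zero>"
    using split[of "\<one>\<^bsub>S\<^esub>"] hom(2)[of h] c[of h] by simp
  then show ?case using zero_on_A insert.prems(4) by auto
qed

section \<open>Combinations of automorphisms\<close>

text \<open>
  The left \<open>L\<close>-module spanned by a set of maps. Building it one term at a time makes its closure
  properties plain inductions; an explicit sum with one coefficient per map is recovered in
  \<open>combinations_finsum\<close>.
\<close>

inductive_set combinations :: "('a, 'm) ring_scheme \<Rightarrow> ('a \<Rightarrow> 'a) set \<Rightarrow> ('a \<Rightarrow> 'a) set"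
  for L :: "('a, 'm) ring_scheme" (structure) and G :: "('a \<Rightarrow> 'a) set"
  where
    zero: "(\<lambda>x\<in>carrier L. \<zero>) \<in> combinations L G"
  | add_term: "\<lbrakk>f \<in> combinations L G; a \<in> carrier L; g \<in> G\<rbrakk>
      \<Longrightarrow> (\<lambda>x\<in>carrier L. f x \<oplus> a \<otimes> g x) \<in> combinations L G"

lemma gal_closed: "g \<in> gal L F \<Longrightarrow> x \<in> carrier L \<Longrightarrow> g x \<in> carrier L"
  and gal_mult: "g \<in> gal L F \<Longrightarrow> x \<in> carrier L \<Longrightarrow> y \<in> carrier L
      \<Longrightarrow> g (x \<otimes>\<^bsub>L\<^esub> y) = g x \<otimes>\<^bsub>L\<^esub> g y"
  and gal_add: "g \<in> gal L F \<Longrightarrow> x \<in> carrier L \<Longrightarrow> y \<in> carrier L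
      \<Longrightarrow> g (x \<oplus>\<^bsub>L\<^esub> y) = g x \<oplus>\<^bsub>L\<^esub> g y"
  and gal_one: "g \<in> gal L F \<Longrightarrow> g \<one>\<^bsub>L\<^esub> = \<one>\<^bsub>L\<^esub>"
  and gal_extensional: "g \<in> gal L F \<Longrightarrow> g \<in> extensional (carrier L)"
  by (auto simp: gal_def dest: ring_iso_memE)

lemma (in ring) gal_zero: "g \<in> gal R F \<Longrightarrow> g \<zero> = \<zero>"
  using gal_add[of g R F \<zero> \<zero>] gal_closed[of g R F \<zero>] by simp

lemma (in ring) gal_id: "F \<subseteq> carrier R \<Longrightarrow> (\<lambda>x\<in>carrier R. x) \<in> gal R F"
  by (auto simp: gal_def ring_iso_def ring_hom_def bij_betw_def inj_on_def)

lemma (in ring) gal_compose: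
  assumes "F \<subseteq> carrier R" "g \<in> gal R F" "h \<in> gal R F"
  shows "compose (carrier R) g h \<in> gal R F"
proof -
  have "(g \<circ> h) \<in> ring_iso R R"
    using assms by (intro ring_iso_set_trans) (auto simp: gal_def)
  then have "compose (carrier R) g h \<in> ring_iso R R"
    by (rule ring_iso_restrict) (simp add: compose_def)
  then show ?thesis
    using assms by (auto simp: gal_def compose_def)
qed

lemma (in ring) combinations_closed:
  assumes "f \<in> combinations R (gal R F)" "x \<in> carrier R"
  shows "f x \<in> carrier R"
  using assms by induction (auto simp: gal_closed)

lemma (in ring) combinations_extensional:
  assumes "f \<in> combinations R G"
  shows "f \<in> extensional (carrier R)"
  using assms by induction (simp_all only: restrict_extensional)

lemma (in ring) combinations_term:
  assumes "a \<in> carrier R" "g \<in> gal R F"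
  shows "(\<lambda>x\<in>carrier R. a \<otimes> g x) \<in> combinations R (gal R F)"
proof -
  have "(\<lambda>x\<in>carrier R. a \<otimes> g x)
      = (\<lambda>x\<in>carrier R. (\<lambda>x\<in>carrier R. \<zero>) x \<oplus> a \<otimes> g x)"
    using assms by (auto simp: restrict_def gal_closed)
  then show ?thesis
    using combinations.add_term[OF combinations.zero assms] by simp
qed

lemma (in ring) combinations_add:
  assumes "f \<in> combinations R (gal R F)" "h \<in> combinations R (gal R F)"
  shows "(\<lambda>x\<in>carrier R. f x \<oplus> h x) \<in> combinations R (gal R F)"
  using assms(2)
proof induction
  case zero
  have eq: "(\<lambda>x\<in>carrier R. f x \<oplus> (\<lambda>x\<in>carrier R. \<zero>) x) = f"
    using combinations_closed[OF assms(1)] combinations_extensional[OF assms(1)]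
    by (auto simp: fun_eq_iff extensional_def)
  show ?case unfolding eq by (rule assms(1))
next
  case (add_term h a g)
  have eq: "(\<lambda>x\<in>carrier R. f x \<oplus> (\<lambda>x\<in>carrier R. h x \<oplus> a \<otimes> g x) x)
      = (\<lambda>x\<in>carrier R. (\<lambda>x\<in>carrier R. f x \<oplus> h x) x \<oplus> a \<otimes> g x)"
    using add_term.hyps combinations_closed[OF assms(1)] combinations_closed[OF add_term.hyps(1)]
    by (auto simp: fun_eq_iff gal_closed a_assoc)
  show ?case
    unfolding eq by (rule combinations.add_term[OF add_term.IH add_term.hyps(2,3)])
qed

text \<open>The twisted multiplication rule: \<open>(a g) \<circ> (b k) = a g(b) (g \<circ> k)\<close>.\<close>

lemma (in cring) combinations_compose_term:
  assumes F: "F \<subseteq> carrier R" and "a \<in> carrier R" "g \<in> gal R F" "h \<in> combinations R (gal R F)"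
  shows "(\<lambda>x\<in>carrier R. a \<otimes> g (h x)) \<in> combinations R (gal R F)"
  using assms(4)
proof induction
  case zero
  have eq: "(\<lambda>x\<in>carrier R. a \<otimes> g ((\<lambda>x\<in>carrier R. \<zero>) x)) = (\<lambda>x\<in>carrier R. \<zero>)"
    using assms(2) gal_zero[OF assms(3)] by (auto simp: fun_eq_iff)
  show ?case unfolding eq by (rule combinations.zero)
next
  case (add_term h b k)
  have eq: "(\<lambda>x\<in>carrier R. a \<otimes> g ((\<lambda>x\<in>carrier R. h x \<oplus> b \<otimes> k x) x))
      = (\<lambda>x\<in>carrier R. (\<lambda>x\<in>carrier R. a \<otimes> g (h x)) x
           \<oplus> (a \<otimes> g b) \<otimes> compose (carrier R) g k x)"
    using add_term.hyps assms(2,3) combinations_closed[OF add_term.hyps(1)]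
    by (auto simp: fun_eq_iff gal_closed gal_add[OF assms(3)] gal_mult[OF assms(3)] m_assoc r_distr
        compose_def)
  have "a \<otimes> g b \<in> carrier R"
    using assms(2,3) add_term.hyps by (simp add: gal_closed)
  then show ?case
    unfolding eq
    by (rule combinations.add_term[OF add_term.IH _ gal_compose[OF F assms(3) add_term.hyps(3)]])
qed

lemma (in cring) combinations_compose:
  assumes F: "F \<subseteq> carrier R"
    and "f \<in> combinations R (gal R F)" and h: "h \<in> combinations R (gal R F)"
  shows "compose (carrier R) f h \<in> combinations R (gal R F)"
  using assms(2)
proof induction
  case zero
  have eq: "compose (carrier R) (\<lambda>x\<in>carrier R. \<zero>) h = (\<lambda>x\<in>carrier R. \<zero>)"
    using combinations_closed[OF h] by (auto simp: fun_eq_iff compose_def)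
  show ?case unfolding eq by (rule combinations.zero)
next
  case (add_term f a g)
  have eq: "compose (carrier R) (\<lambda>x\<in>carrier R. f x \<oplus> a \<otimes> g x) h
      = (\<lambda>x\<in>carrier R. compose (carrier R) f h x \<oplus> (\<lambda>x\<in>carrier R. a \<otimes> g (h x)) x)"
    using combinations_closed[OF h] by (auto simp: fun_eq_iff compose_def)
  show ?case
    unfolding eq
    by (rule combinations_add[OF add_term.IH combinations_compose_term[OF F add_term.hyps(2,3) h]])
qed

section \<open>The crossed algebra as the set of combinations\<close>

lemma end_algebra_simps:
  "\<one>\<^bsub>end_algebra L F\<^esub> = (\<lambda>x\<in>carrier L. x)"
  "\<zero>\<^bsub>end_algebra L F\<^esub> = (\<lambda>x\<in>carrier L. \<zero>\<^bsub>L\<^esub>)"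
  "f \<otimes>\<^bsub>end_algebra L F\<^esub> g = compose (carrier L) f g"
  "f \<oplus>\<^bsub>end_algebra L F\<^esub> g = (\<lambda>x\<in>carrier L. f x \<oplus>\<^bsub>L\<^esub> g x)"
  by (simp_all add: end_algebra_def)

lemma (in field) term_in_subring:
  assumes B: "subring B (end_algebra R F)" "mult_map R ` carrier R \<subseteq> B" "gal R F \<subseteq> B"
    and "a \<in> carrier R" "g \<in> gal R F"
  shows "(\<lambda>x\<in>carrier R. a \<otimes> g x) \<in> B"
proof -
  have "mult_map R a \<otimes>\<^bsub>end_algebra R F\<^esub> g \<in> B"
    using assms subringE(6)[OF B(1), of "mult_map R a" g] by auto
  moreover have "mult_map R a \<otimes>\<^bsub>end_algebra R F\<^esub> g = (\<lambda>x\<in>carrier R. a \<otimes> g x)"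
    using assms(4,5) by (auto simp: end_algebra_simps mult_map_def compose_def fun_eq_iff gal_closed)
  ultimately show ?thesis by simp
qed

lemma (in field) combinations_in_subring:
  assumes B: "subring B (end_algebra R F)" "mult_map R ` carrier R \<subseteq> B" "gal R F \<subseteq> B"
    and "f \<in> combinations R (gal R F)"
  shows "f \<in> B"
  using assms(4)
proof induction
  case zero
  show ?case using subringE(2)[OF B(1)] unfolding end_algebra_simps .
next
  case (add_term f a g)
  have "f \<oplus>\<^bsub>end_algebra R F\<^esub> (\<lambda>x\<in>carrier R. a \<otimes> g x) \<in> B"
    using add_term.IH term_in_subring[OF B add_term.hyps(2,3)] by (rule subringE(7)[OF B(1)])
  moreover have "f \<oplus>\<^bsub>end_algebra R F\<^esub> (\<lambda>x\<in>carrier R. a \<otimes> g x)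
      = (\<lambda>x\<in>carrier R. f x \<oplus> a \<otimes> g x)"
    by (auto simp: end_algebra_simps fun_eq_iff)
  ultimately show ?case by (simp only:)
qed

lemma (in field) combinations_subset_end_algebra:
  assumes "subfield F R"
  shows "combinations R (gal R F) \<subseteq> carrier (end_algebra R F)"
proof
  interpret E: ring "end_algebra R F" by (rule ring_end_algebra[OF field_axioms assms])
  have F: "F \<subseteq> carrier R" using subfieldE(3)[OF assms] .
  have mult: "mult_map R ` carrier R \<subseteq> carrier (end_algebra R F)"
    using mult_map_in_end_algebra[OF field_axioms F] by auto
  fix f assume "f \<in> combinations R (gal R F)"
  then show "f \<in> carrier (end_algebra R F)"
    by (rule combinations_in_subring[OF E.carrier_is_subring mult gal_subset_end_algebra[OF F]])
qed

lemma (in field) mult_map_in_combinations: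
  assumes "F \<subseteq> carrier R" "a \<in> carrier R"
  shows "mult_map R a \<in> combinations R (gal R F)"
proof -
  have "mult_map R a = (\<lambda>x\<in>carrier R. a \<otimes> (\<lambda>x\<in>carrier R. x) x)"
    by (auto simp: mult_map_def fun_eq_iff)
  then show ?thesis using combinations_term[OF assms(2) gal_id[OF assms(1)]] by simp
qed

lemma (in field) gal_subset_combinations:
  "gal R F \<subseteq> combinations R (gal R F)"
proof
  fix g assume g: "g \<in> gal R F"
  have "(\<lambda>x\<in>carrier R. \<one> \<otimes> g x) = g"
    using g gal_extensional[OF g] by (auto simp: fun_eq_iff extensional_def gal_closed)
  then show "g \<in> combinations R (gal R F)"
    using combinations_term[OF one_closed g] by simp
qed

lemma (in field) subring_combinations:
  assumes "subfield F R"
  shows "subring (combinations R (gal R F)) (end_algebra R F)"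
proof -
  interpret E: ring "end_algebra R F" by (rule ring_end_algebra[OF field_axioms assms])
  have F: "F \<subseteq> carrier R" using subfieldE(3)[OF assms] .
  have carr: "combinations R (gal R F) \<subseteq> carrier (end_algebra R F)"
    by (rule combinations_subset_end_algebra[OF assms])
  show ?thesis
  proof (rule E.subringI)
    show "\<one>\<^bsub>end_algebra R F\<^esub> \<in> combinations R (gal R F)"
      using gal_id[OF F] gal_subset_combinations by (auto simp: end_algebra_simps)
  next
    fix h assume h: "h \<in> combinations R (gal R F)"
    \<comment> \<open>The negative of \<open>h\<close> is the composite of \<open>h\<close> with multiplication by \<open>-1\<close>.\<close>
    let ?n = "compose (carrier R) (mult_map R (\<ominus> \<one>)) h"
    have n: "?n \<in> combinations R (gal R F)"
      using combinations_compose[OF F mult_map_in_combinations[OF F] h] by simp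
    have "?n \<oplus>\<^bsub>end_algebra R F\<^esub> h = \<zero>\<^bsub>end_algebra R F\<^esub>"
      using combinations_closed[OF h]
      by (auto simp: end_algebra_simps fun_eq_iff compose_def mult_map_def l_minus l_neg)
    then have "\<ominus>\<^bsub>end_algebra R F\<^esub> h = ?n"
      using n h carr by (intro E.minus_equality) auto
    then show "\<ominus>\<^bsub>end_algebra R F\<^esub> h \<in> combinations R (gal R F)" using n by simp
  qed (use carr combinations_compose[OF F] combinations_add in \<open>auto simp: end_algebra_simps\<close>)
qed

lemma (in field) crossed_algebra_eq_combinations:
  assumes "subfield F R"
  shows "crossed_algebra R F = combinations R (gal R F)"
proof
  have F: "F \<subseteq> carrier R" using subfieldE(3)[OF assms] .
  have sub: "subring (combinations R (gal R F)) (end_algebra R F)"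
    by (rule subring_combinations[OF assms])
  have "subalgebra (mult_map R ` F) (combinations R (gal R F)) (end_algebra R F)"
  proof (intro subalgebra.intro subalgebra_axioms.intro)
    show "subgroup (combinations R (gal R F)) (add_monoid (end_algebra R F))"
      using subring.axioms(1)[OF sub] .
    show "k \<otimes>\<^bsub>end_algebra R F\<^esub> v \<in> combinations R (gal R F)"
      if "k \<in> mult_map R ` F" "v \<in> combinations R (gal R F)" for k v
      using that F mult_map_in_combinations[OF F] by (intro subringE(6)[OF sub]) auto
  qed
  with sub show "crossed_algebra R F \<subseteq> combinations R (gal R F)"
    using mult_map_in_combinations[OF F] gal_subset_combinations[of F]
    unfolding crossed_algebra_def by (intro Inter_lower) auto
  show "combinations R (gal R F) \<subseteq> crossed_algebra R F"
    unfolding crossed_algebra_def using combinations_in_subring by blast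
qed

section \<open>Combinations commuting with an intermediate field\<close>

lemma (in field) combinations_finsum:
  assumes "f \<in> combinations R (gal R F)"
  shows "\<exists>A c. finite A \<and> A \<subseteq> gal R F \<and> c \<in> A \<rightarrow> carrier R \<and>
    f = (\<lambda>x\<in>carrier R. \<Oplus>g\<in>A. c g \<otimes> g x)"
  using assms
proof induction
  case zero
  show ?case by (rule exI[of _ "{}"]) auto
next
  case (add_term f a g)
  then obtain A c where A: "finite A" "A \<subseteq> gal R F" "c \<in> A \<rightarrow> carrier R"
    and f: "f = (\<lambda>x\<in>carrier R. \<Oplus>g\<in>A. c g \<otimes> g x)" by blast
  have cl: "c k \<otimes> k x \<in> carrier R" if "k \<in> A" "x \<in> carrier R" for k x
    using that A gal_closed[of k R F x] by auto
  \<comment> \<open>The automorphism \<open>g\<close> may already occur in the sum, and then the new term changes its coefficient.\<close>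
  define b where "b = (if g \<in> A then c g else \<zero>)"
  have b: "b \<in> carrier R" using A by (auto simp: b_def)
  define c' where "c' = c(g := b \<oplus> a)"
  have "f x \<oplus> a \<otimes> g x = (\<Oplus>k\<in>insert g A. c' k \<otimes> k x)" if x: "x \<in> carrier R" for x
  proof -
    have gx: "g x \<in> carrier R" using add_term.hyps x by (simp add: gal_closed)
    have rest: "(\<Oplus>k\<in>A - {g}. c' k \<otimes> k x) = (\<Oplus>k\<in>A - {g}. c k \<otimes> k x)"
      using cl x by (intro finsum_cong') (auto simp: c'_def)
    have rest_cl: "(\<Oplus>k\<in>A - {g}. c k \<otimes> k x) \<in> carrier R"
      using cl x by (intro finsum_closed) auto
    have "(\<Oplus>k\<in>insert g A. c' k \<otimes> k x) = (\<Oplus>k\<in>insert g (A - {g}). c' k \<otimes> k x)" by simp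
    also have "\<dots> = c' g \<otimes> g x \<oplus> (\<Oplus>k\<in>A - {g}. c' k \<otimes> k x)"
      using A cl x gx b add_term.hyps by (intro finsum_insert) (auto simp: c'_def)
    finally have new: "(\<Oplus>k\<in>insert g A. c' k \<otimes> k x)
        = (b \<oplus> a) \<otimes> g x \<oplus> (\<Oplus>k\<in>A - {g}. c k \<otimes> k x)"
      unfolding rest by (simp add: c'_def)
    have "f x = b \<otimes> g x \<oplus> (\<Oplus>k\<in>A - {g}. c k \<otimes> k x)"
    proof (cases "g \<in> A")
      case True
      then have "(\<Oplus>k\<in>A. c k \<otimes> k x) = (\<Oplus>k\<in>insert g (A - {g}). c k \<otimes> k x)"
        by (simp add: insert_absorb)
      also have "\<dots> = c g \<otimes> g x \<oplus> (\<Oplus>k\<in>A - {g}. c k \<otimes> k x)"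
        using A cl[OF True x] cl x by (intro finsum_insert) auto
      finally show ?thesis using True x by (simp add: f b_def)
    next
      case False
      then show ?thesis using x gx rest_cl by (simp add: f b_def)
    qed
    then show ?thesis
      unfolding new using b gx rest_cl add_term.hyps(2) by (simp add: l_distr a_ac)
  qed
  then have "(\<lambda>x\<in>carrier R. f x \<oplus> a \<otimes> g x) = (\<lambda>x\<in>carrier R. \<Oplus>k\<in>insert g A. c' k \<otimes> k x)"
    by (auto simp: fun_eq_iff)
  moreover have "finite (insert g A)" "insert g A \<subseteq> gal R F" "c' \<in> insert g A \<rightarrow> carrier R"
    using A b add_term.hyps by (auto simp: c'_def)
  ultimately show ?case by blast
qed

text \<open>
  This is how a sum over \<open>G(L/K)\<close> becomes one over the smaller group \<open>G(L/M)\<close>: automorphisms outside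
  the smaller group enter with coefficient zero and drop out.
\<close>

lemma (in field) finsum_in_combinations:
  assumes "finite A" "\<And>g. g \<in> A \<Longrightarrow> c g = \<zero> \<or> g \<in> gal R F"
    and "A \<subseteq> gal R F'" "c \<in> A \<rightarrow> carrier R"
  shows "(\<lambda>x\<in>carrier R. \<Oplus>g\<in>A. c g \<otimes> g x) \<in> combinations R (gal R F)"
  using assms
proof (induction A rule: finite_induct)
  case empty
  show ?case using combinations.zero[of R] by (simp only: finsum_empty)
next
  case (insert h A)
  let ?f = "\<lambda>x\<in>carrier R. \<Oplus>g\<in>A. c g \<otimes> g x"
  have cl: "c k \<otimes> k x \<in> carrier R" "k x \<in> carrier R"
    if "k \<in> insert h A" "x \<in> carrier R" for k x
    using that insert.prems(2,3) gal_closed[of k R F' x] by auto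
  have eq: "(\<lambda>x\<in>carrier R. \<Oplus>g\<in>insert h A. c g \<otimes> g x)
      = (\<lambda>x\<in>carrier R. ?f x \<oplus> c h \<otimes> h x)"
  proof (intro restrict_ext)
    fix x assume x: "x \<in> carrier R"
    have "(\<Oplus>g\<in>insert h A. c g \<otimes> g x) = c h \<otimes> h x \<oplus> (\<Oplus>g\<in>A. c g \<otimes> g x)"
      using insert.hyps cl(1) x by (intro finsum_insert) auto
    moreover have "(\<Oplus>g\<in>A. c g \<otimes> g x) \<in> carrier R"
      using cl(1) x by (intro finsum_closed) auto
    ultimately show "(\<Oplus>g\<in>insert h A. c g \<otimes> g x) = ?f x \<oplus> c h \<otimes> h x"
      using x cl(1)[of h x] by (simp add: a_comm)
  qed
  have IH: "?f \<in> combinations R (gal R F)"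
    using insert.prems by (intro insert.IH) auto
  show ?case
  proof (cases "c h = \<zero>")
    case True
    then have eq': "(\<lambda>x\<in>carrier R. ?f x \<oplus> c h \<otimes> h x) = ?f"
      using cl(2) combinations_closed[OF IH] by (auto simp: fun_eq_iff)
    show ?thesis unfolding eq eq' by (rule IH)
  next
    case False
    then have "h \<in> gal R F" using insert.prems(1) by blast
    then show ?thesis
      unfolding eq using insert.prems(3) by (intro combinations.add_term[OF IH]) auto
  qed
qed

text \<open>
  Independence of characters, applied to \<open>f (m x) - m f x = \<Sum> c\<^sub>g (g m - m) g x\<close>, shows that an
  automorphism with a nonzero coefficient fixes every \<open>m \<in> M\<close>.
\<close>

lemma (in field) combination_commuting_with_subfield:
  assumes "f \<in> combinations R (gal R K)" and M: "M \<subseteq> carrier R"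
    and lin: "\<And>m x. m \<in> M \<Longrightarrow> x \<in> carrier R \<Longrightarrow> f (m \<otimes> x) = m \<otimes> f x"
  shows "f \<in> combinations R (gal R M)"
proof -
  obtain A c where A: "finite A" "A \<subseteq> gal R K" "c \<in> A \<rightarrow> carrier R"
    and f: "f = (\<lambda>x\<in>carrier R. \<Oplus>g\<in>A. c g \<otimes> g x)"
    using combinations_finsum[OF assms(1)] by blast
  have c: "c g \<in> carrier R" if "g \<in> A" for g using that A by auto
  have val: "g x \<in> carrier R" if "g \<in> A" "x \<in> carrier R" for g x
    using that A gal_closed[of g R K x] by auto
  have vanish: "c g \<otimes> (g m \<ominus> m) = \<zero>" if g: "g \<in> A" and m: "m \<in> M" for g m
  proof (rule independence_of_characters[where S = R and A = A and c = "\<lambda>g. c g \<otimes> (g m \<ominus> m)"])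
    have mR: "m \<in> carrier R" using m M by auto
    show "Group.monoid R" by (rule monoid_axioms)
    show "finite A" "g \<in> A" by fact+
    show "h \<in> hom R R \<inter> extensional (carrier R) \<and> h \<one> = \<one>" if "h \<in> A" for h
      using A that gal_mult[of h R K] gal_one[of h R K] gal_extensional[of h R K] val[OF that]
      by (auto simp: hom_def)
    show "(\<lambda>g. c g \<otimes> (g m \<ominus> m)) \<in> A \<rightarrow> carrier R"
      using c val mR by auto
    show "(\<Oplus>g\<in>A. c g \<otimes> (g m \<ominus> m) \<otimes> g x) = \<zero>" if x: "x \<in> carrier R" for x
    proof -
      have "(\<Oplus>g\<in>A. c g \<otimes> (g m \<ominus> m) \<otimes> g x)
          = (\<Oplus>g\<in>A. c g \<otimes> g (m \<otimes> x) \<oplus> \<ominus> m \<otimes> (c g \<otimes> g x))"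
      proof (rule finsum_cong')
        fix k assume k: "k \<in> A"
        have "k (m \<otimes> x) = k m \<otimes> k x" using k A gal_mult[of k R K m x] mR x by auto
        then show "c k \<otimes> (k m \<ominus> m) \<otimes> k x = c k \<otimes> k (m \<otimes> x) \<oplus> \<ominus> m \<otimes> (c k \<otimes> k x)"
          using c[OF k] val[OF k mR] val[OF k x] mR
            by (simp add: a_minus_def l_distr r_distr l_minus r_minus m_ac)
      qed (use c val mR x in auto)
      also have "\<dots> = (\<Oplus>g\<in>A. c g \<otimes> g (m \<otimes> x)) \<oplus> (\<Oplus>g\<in>A. \<ominus> m \<otimes> (c g \<otimes> g x))"
        using c val mR x by (intro finsum_addf) auto
      also have "(\<Oplus>g\<in>A. \<ominus> m \<otimes> (c g \<otimes> g x)) = \<ominus> m \<otimes> (\<Oplus>g\<in>A. c g \<otimes> g x)"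
        using A c val mR x by (intro finsum_rdistr[symmetric]) auto
      also have "(\<Oplus>g\<in>A. c g \<otimes> g (m \<otimes> x)) \<oplus> \<ominus> m \<otimes> (\<Oplus>g\<in>A. c g \<otimes> g x)
          = f (m \<otimes> x) \<oplus> \<ominus> m \<otimes> f x"
        using mR x by (simp add: f)
      also have "\<dots> = \<zero>"
        using lin[OF m x] combinations_closed[OF assms(1) x] mR by (simp add: l_minus r_neg)
      finally show ?thesis .
    qed
  qed
  have "c g = \<zero> \<or> g \<in> gal R M" if g: "g \<in> A" for g
  proof (cases "c g = \<zero>")
    case False
    have "g m = m" if m: "m \<in> M" for m
    proof -
      have mR: "m \<in> carrier R" using m M by auto
      have "g m \<ominus> m = \<zero>"
        using vanish[OF g m] False integral c[OF g] val[OF g mR] mR by blast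
      then show ?thesis using val[OF g mR] mR by simp
    qed
    then show ?thesis using g A by (auto simp: gal_def)
  qed simp
  then show ?thesis
    unfolding f using A by (intro finsum_in_combinations) auto
qed

lemma (in field) finite_dimension_over_larger_subfield:
  assumes "subfield K R" "subfield M R" "K \<subseteq> M"
    and "finite_dimension K (carrier R)"
  shows "finite_dimension M (carrier R)"
proof -
  obtain n where "dimension n K (carrier R)"
    using assms(4) unfolding finite_dimension_def by blast
  then obtain Us where Us: "set Us \<subseteq> carrier R" "Span K Us = carrier R"
    using exists_base[OF assms(1)] by blast
  have "K <#> set Us \<subseteq> Span M Us"
    using Span_incl[OF assms(2) Us(1)] assms(3) unfolding set_mult_def by blast
  then have "carrier R \<subseteq> Span M Us"
    using Span_min[OF assms(1) Us(1) Span_is_add_subgroup[OF assms(2) Us(1)]] Us(2) by simp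
  then have "Span M Us = carrier R"
    using Span_subgroup_props(1)[OF assms(2) Us(1)] by blast
  moreover obtain Vs where "independent M Vs" "Span M Vs = Span M Us"
    using filter_base[OF assms(2) Us(1)] by blast
  ultimately show ?thesis
    using dimension_independent[of M Vs] finite_dimensionI by metis
qed

theorem lemma3p5:
  fixes L :: "('a, 'm) ring_scheme" and K M :: "'a set"
  assumes "G_extension L K"
    and "subfield M L" and "K \<subseteq> M"
  shows "G_extension L M"
proof -
  have L: "field L" "subfield K L" "ring.finite_dimension L K (carrier L)"
    and E: "carrier (end_algebra L K) = crossed_algebra L K"
    using assms(1) by (auto simp: G_extension_def)
  interpret L: field L by fact
  have M: "M \<subseteq> carrier L" using subfieldE(3)[OF assms(2)] .
  have "carrier (end_algebra L M) = combinations L (gal L M)"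
  proof
    show "combinations L (gal L M) \<subseteq> carrier (end_algebra L M)"
      by (rule L.combinations_subset_end_algebra[OF assms(2)])
    show "carrier (end_algebra L M) \<subseteq> combinations L (gal L M)"
    proof
      fix f assume f: "f \<in> carrier (end_algebra L M)"
      then have "f \<in> carrier (end_algebra L K)"
        using assms(3) by (auto simp: end_algebra_def)
      then have "f \<in> combinations L (gal L K)"
        using E L.crossed_algebra_eq_combinations[OF L(2)] by simp
      moreover have "f (m \<otimes>\<^bsub>L\<^esub> x) = m \<otimes>\<^bsub>L\<^esub> f x" if "m \<in> M" "x \<in> carrier L" for m x
        using f that by (auto simp: end_algebra_def)
      ultimately show "f \<in> combinations L (gal L M)"
        by (rule L.combination_commuting_with_subfield[OF _ M])
    qed
  qed
  then have "carrier (end_algebra L M) = crossed_algebra L M"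
    using L.crossed_algebra_eq_combinations[OF assms(2)] by simp
  then show ?thesis
    unfolding G_extension_def
    using L(1) assms(2) L.finite_dimension_over_larger_subfield[OF L(2) assms(2,3) L(3)] by simp
qed

end
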